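(* Let $\alpha\in(0,2)$, $N=2$, let $\mathcal{N}$ be a norm on $\mathbb{R}^2$, $a,b>0$ and $q\in[1,+\infty)\cup\{+\infty\}$, and let $\lambda_\alpha>0$ be the constant defined by $\lambda_\alpha^{-1}=\int_0^{+\infty}\frac{dt}{1+t^{2+\alpha}}$. The convex set $\{\Phi_\alpha\le1\}$ is as regular as the convex set $\{\mathcal{N}\le1\}$, which has at least a Lipschitz boundary. In particular, if $\{\Phi_\alpha\le1\}=\{(p_1,p_2):\frac{p_1^2}{a^2}+\frac{p_2^2}{b^2}\le1\}$ or $\{\Phi_\alpha\le1\}=\{p:\|p\|_q\le1\}$, then it holds $\{\mathcal{N}\le1\}=\{(p_1,p_2):\frac{p_1^2}{b^2}+\frac{p_2^2}{a^2}\le\lambda_\alpha^2\}$ or $\{\mathcal{N}\le1\}=\{p:\|p\|_q\le\lambda_\alpha\}$, respectively.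
   Context: $\Phi_\alpha$ is the $1$-homogeneous function on $\mathbb{R}^2$ given, for $p\in\mathbb{R}^2\setminus\{0\}$, by $\Phi_\alpha(p)=\Big(2\int_{p^\perp}\frac{d\mathcal{H}^{1}(x)}{1+\mathcal{N}(x)^{2+\alpha}}\Big)^{-1}|p|$, where $p^\perp=\{x\in\mathbb{R}^2:\langle x,p\rangle=0\}$, $\mathcal{H}^1$ is the one-dimensional Hausdorff measure and $|\cdot|$ is the Euclidean norm; $\Phi_\alpha(0)=0$. $\|\cdot\|_q$ is the usual $\ell^q$ norm on $\mathbb{R}^2$.
   Formalization: In both final formulas for {N≤1}, λ_α is replaced by λ_α/4: with the given Φ_α one has Φ_α(p)=(λ_α/4)N(p rotated by 90°), so the printed constants fail, e.g. for N Euclidean and a=b=4/λ_α. *)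

theory Defs
  imports "HOL-Analysis.Analysis"
begin

definition is_norm :: "('a::real_vector \<Rightarrow> real) \<Rightarrow> bool" where
  "is_norm N \<longleftrightarrow>
     (\<forall>x. 0 \<le> N x) \<and> (\<forall>x. N x = 0 \<longleftrightarrow> x = 0) \<and>
     (\<forall>c x. N (c *\<^sub>R x) = \<bar>c\<bar> * N x) \<and>
     (\<forall>x y. N (x + y) \<le> N x + N y)"

(* The library function diameter is only meaningful on bounded sets, hence the boundedness
   requirement on the covering sets. In dimension one the normalising constant of the
   Hausdorff measure is 1. *)

definition hausdorff1_pre :: "real \<Rightarrow> 'a::metric_space set \<Rightarrow> ennreal" where
  "hausdorff1_pre \<delta> A =
     (INF U \<in> {U :: nat \<Rightarrow> 'a set. A \<subseteq> (\<Union>i. U i) \<and> (\<forall>i. bounded (U i) \<and> diameter (U i) \<le> \<delta>)}.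
        \<Sum>i. ennreal (diameter (U i)))"

definition hausdorff1_outer :: "'a::metric_space set \<Rightarrow> ennreal" where
  "hausdorff1_outer A = (SUP \<delta> \<in> {0<..}. hausdorff1_pre \<delta> A)"

definition hausdorff1 :: "'a::metric_space measure" where
  "hausdorff1 = measure_of UNIV (sets borel) hausdorff1_outer"

(* The integral runs over the whole line, so by evenness and homogeneity of N it is twice a
   half-line integral: for a unit vector e spanning the line orthogonal to p it equals
   2 / (lambda * N e), with 1 / lambda the integral of 1 / (1 + t powr (2 + \<alpha>)) over t > 0.
   Together with the factor 2 this gives
   Phi \<alpha> N p = (lambda / 4) * N (p rotated by a right angle). *)

definition Phi :: "real \<Rightarrow> (real^2 \<Rightarrow> real) \<Rightarrow> real^2 \<Rightarrow> real" where
  "Phi \<alpha> N p =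
     (if p = 0 then 0
      else inverse (2 * (LINT x:{x. x \<bullet> p = 0}|hausdorff1. 1 / (1 + N x powr (2 + \<alpha>)))) * norm p)"

definition lq_norm :: "ereal \<Rightarrow> real^'n \<Rightarrow> real" where
  "lq_norm q x =
     (if q = \<infinity> then infnorm x
      else (\<Sum>i\<in>UNIV. \<bar>x $ i\<bar> powr real_of_ereal q) powr (1 / real_of_ereal q))"

(* A regularity class is a predicate R f I on a function and an open interval. The boundary of a
   closed planar set is of class R if near each of its points the set is, in suitable orthonormal
   coordinates centred at that point, the epigraph of a function of class R. *)

definition boundary_of_class ::
    "((real \<Rightarrow> real) \<Rightarrow> real set \<Rightarrow> bool) \<Rightarrow> (real^2) set \<Rightarrow> bool" where
  "boundary_of_class R S \<longleftrightarrow>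
     (\<forall>x\<in>frontier S. \<exists>e \<nu> r f. norm e = 1 \<and> norm \<nu> = 1 \<and> e \<bullet> \<nu> = 0 \<and> r > 0 \<and>
        R f {-r<..<r} \<and>
        (\<forall>y\<in>ball x r. y \<in> S \<longleftrightarrow> f ((y - x) \<bullet> e) \<le> (y - x) \<bullet> \<nu>))"

(* Invariance under simultaneous dilation of domain and graph, so that having a boundary of class
   R does not depend on the unit of length. *)

definition dilation_invariant :: "((real \<Rightarrow> real) \<Rightarrow> real set \<Rightarrow> bool) \<Rightarrow> bool" where
  "dilation_invariant R \<longleftrightarrow>
     (\<forall>f r c. r > 0 \<longrightarrow> c > 0 \<longrightarrow> R f {-r<..<r} \<longrightarrow> R (\<lambda>t. c * f (t / c)) {-(c * r)<..<c * r})"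

definition lipschitz_class :: "(real \<Rightarrow> real) \<Rightarrow> real set \<Rightarrow> bool" where
  "lipschitz_class f I \<longleftrightarrow> (\<exists>L. L-lipschitz_on I f)"

definition Ck_class :: "nat \<Rightarrow> (real \<Rightarrow> real) \<Rightarrow> real set \<Rightarrow> bool" where
  "Ck_class k f I \<longleftrightarrow>
     (\<forall>j<k. \<forall>t\<in>I. (deriv ^^ j) f differentiable (at t)) \<and> continuous_on I ((deriv ^^ k) f)"

definition Ck_holder_class :: "nat \<Rightarrow> real \<Rightarrow> (real \<Rightarrow> real) \<Rightarrow> real set \<Rightarrow> bool" where
  "Ck_holder_class k \<gamma> f I \<longleftrightarrow>
     Ck_class k f I \<and>
     (\<exists>C. \<forall>s\<in>I. \<forall>t\<in>I. \<bar>(deriv ^^ k) f s - (deriv ^^ k) f t\<bar> \<le> C * \<bar>s - t\<bar> powr \<gamma>)"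

definition Cinf_class :: "(real \<Rightarrow> real) \<Rightarrow> real set \<Rightarrow> bool" where
  "Cinf_class f I \<longleftrightarrow> (\<forall>k. Ck_class k f I)"

definition analytic_class :: "(real \<Rightarrow> real) \<Rightarrow> real set \<Rightarrow> bool" where
  "analytic_class f I \<longleftrightarrow>
     (\<forall>t\<^sub>0\<in>I. \<exists>a \<rho>. \<rho> > 0 \<and> (\<forall>t\<in>I. \<bar>t - t\<^sub>0\<bar> < \<rho> \<longrightarrow> (\<lambda>n. a n * (t - t\<^sub>0) ^ n) sums f t))"

(* S is exactly as regular as T: their boundaries belong to the same dilation invariant
   regularity classes, in particular to the same classical ones. *)

definition as_regular_as :: "(real^2) set \<Rightarrow> (real^2) set \<Rightarrow> bool" where
  "as_regular_as S T \<longleftrightarrow>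
     (\<forall>R. dilation_invariant R \<longrightarrow> (boundary_of_class R S \<longleftrightarrow> boundary_of_class R T)) \<and>
     (boundary_of_class lipschitz_class S \<longleftrightarrow> boundary_of_class lipschitz_class T) \<and>
     (\<forall>k. boundary_of_class (Ck_class k) S \<longleftrightarrow> boundary_of_class (Ck_class k) T) \<and>
     (\<forall>k \<gamma>. 0 < \<gamma> \<longrightarrow> \<gamma> \<le> 1 \<longrightarrow>
        (boundary_of_class (Ck_holder_class k \<gamma>) S \<longleftrightarrow> boundary_of_class (Ck_holder_class k \<gamma>) T)) \<and>
     (boundary_of_class Cinf_class S \<longleftrightarrow> boundary_of_class Cinf_class T) \<and>
     (boundary_of_class analytic_class S \<longleftrightarrow> boundary_of_class analytic_class T)"

end

theory Submission
  imports Defs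
begin

text \<open>
  The one-dimensional Hausdorff measure is a metric outer measure, hence a measure on the Borel
  sets, and on a line it is the image of the Lebesgue measure under arc length. Evenness and
  homogeneity of \<open>N\<close> then give \<open>Phi \<alpha> N p = lam / 4 * N (rot p)\<close> with \<open>rot\<close> the
  rotation by a right angle, so the unit ball of \<open>Phi\<close> is a rotated dilate of that of \<open>N\<close>. A
  similarity carries one boundary to the other and preserves every dilation invariant regularity
  class. The unit ball of a norm has Lipschitz boundary because, near a boundary point \<open>x\<close>, it
  is the epigraph over the line orthogonal to \<open>x\<close> of a function that convexity makes Lipschitz.
\<close>

text \<open>Two default values shape the argument. \<open>measure_of\<close> yields the zero measure
  unless the given set function is countably additive on the generated sigma-algebra, so no value of
  \<open>hausdorff1\<close> is accessible before Caratheodory's criterion is established for all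
  Borel sets. A Bochner integral of a non-integrable function is 0, so the hypothesis on
  \<open>lam\<close>, together with \<open>0 < lam\<close>, already contains the integrability of
  the profile \<open>1 / (1 + t powr (2 + \<alpha>))\<close>. Regularity is compared through one
  fact about an arbitrary dilation invariant class; each of the classical classes then only has to
  be shown dilation invariant.\<close>

section \<open>The one-dimensional Hausdorff measure\<close>

text \<open>
  Caratheodory's criterion: splitting the complement of \<open>C\<close> into shells by the distance to \<open>C\<close>,
  shells with indices of equal parity are mutually separated. Hence the measures of all shells
  have a finite sum, and the shells close to \<open>C\<close> contribute arbitrarily little.
\<close>

lemma metric_outer_measure_closed:
  fixes \<mu> :: "'a::metric_space set \<Rightarrow> ennreal"
  assumes outer: "outer_measure_space UNIV \<mu>"
    and separated: "\<And>A B d. 0 < d \<Longrightarrow> (\<And>a b. a \<in> A \<Longrightarrow> b \<in> B \<Longrightarrow> d \<le> dist a b) \<Longrightarrow>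
      \<mu> A + \<mu> B \<le> \<mu> (A \<union> B)"
    and "closed C"
  shows "C \<in> lambda_system UNIV UNIV \<mu>"
\<comment> \<open>\<open>infdist x {}\<close> is 0 by convention, so shells around the empty set
  would carry no information.\<close>
proof (cases "C = {}")
  case True
  then show ?thesis
    using outer by (auto simp: lambda_system_def outer_measure_space_def positive_def)
next
  case nonempty: False
  have pos: "positive UNIV \<mu>" and inc: "\<And>A B. A \<subseteq> B \<Longrightarrow> \<mu> A \<le> \<mu> B"
    and csub: "countably_subadditive UNIV \<mu>"
    using outer by (auto simp: outer_measure_space_def increasing_def)
  have sub: "\<mu> (A \<union> B) \<le> \<mu> A + \<mu> B" for A B
  proof -
    have "\<mu> (A \<union> (B - A)) \<le> \<mu> A + \<mu> (B - A)"
      using ring_of_sets.countably_subadditive_subadditive[OF ring_of_sets_Pow[of UNIV], of \<mu>] pos csub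
      by (intro subadditiveD) auto
    also have "\<dots> \<le> \<mu> A + \<mu> B"
      by (intro add_left_mono inc) auto
    finally show ?thesis by simp
  qed
  have csub': "\<mu> (\<Union>i. A i) \<le> (\<Sum>i. \<mu> (A i))" if "disjoint_family A" for A :: "nat \<Rightarrow> 'a set"
    using csub that by (auto simp: countably_subadditive_def)
  have "\<mu> (C \<inter> T) + \<mu> ((UNIV - C) \<inter> T) \<le> \<mu> T" for T
  \<comment> \<open>Finiteness of \<open>\<mu> T\<close> is what later allows the sum over all
    shells to be cancelled.\<close>
  proof (cases "\<mu> T = top")
    case True
    then show ?thesis by simp
  next
    case False
    \<comment> \<open>\<open>far n\<close> has distance at least \<open>1 / (n + 1)\<close> from
      \<open>C\<close>; the shells \<open>ring k\<close> with \<open>k \<ge> n\<close> fill the gap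
      between \<open>far n\<close> and \<open>C\<close>.\<close>
    define far where "far n = {x \<in> T. 1 / real (n + 1) \<le> infdist x C}" for n :: nat
    define ring where
      "ring n = {x \<in> T. 1 / real (n + 2) \<le> infdist x C \<and> infdist x C < 1 / real (n + 1)}" for n :: nat
    have ring_sum: "(\<Sum>k<n. \<mu> (ring (2 * k + s))) \<le> \<mu> (\<Union>k<n. ring (2 * k + s))" for n s
    proof (induction n)
      case (Suc n)
      have "(\<Sum>k<Suc n. \<mu> (ring (2 * k + s)))
        \<le> \<mu> (\<Union>k<n. ring (2 * k + s)) + \<mu> (ring (2 * n + s))"
        using Suc by (simp add: add_right_mono)
      also have "\<dots> \<le> \<mu> ((\<Union>k<n. ring (2 * k + s)) \<union> ring (2 * n + s))"
      \<comment> \<open>For \<open>n = 0\<close> the union is empty, and the gap below could involve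
        a division by zero.\<close>
      proof (cases "n = 0")
        case True
        then show ?thesis using pos by (simp add: positive_def)
      next
        case False
        \<comment> \<open>For \<open>k < n\<close>, \<open>2 * k + s + 2 \<le> 2 * n + s\<close>: an
          earlier shell of the same parity stays at distance at least \<open>1 / (2 * n + s)\<close>
          from \<open>C\<close>, while the new one lies within
          \<open>1 / (2 * n + s + 1)\<close>.\<close>
        let ?d = "1 / real (2 * n + s) - 1 / real (2 * n + s + 1)"
        show ?thesis
        proof (rule separated)
          show "0 < ?d"
            using False divide_strict_left_mono[of "real (2 * n + s)" "real (2 * n + s + 1)" 1]
            by simp
          fix a b assume "a \<in> (\<Union>k<n. ring (2 * k + s))" and b: "b \<in> ring (2 * n + s)"
          then obtain k where k: "k < n" "a \<in> ring (2 * k + s)" by auto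
          have "1 / real (2 * n + s) \<le> 1 / real (2 * k + s + 2)"
            using k(1) by (intro divide_left_mono) auto
          also have "\<dots> \<le> infdist a C" using k(2) by (simp add: ring_def)
          also have "\<dots> \<le> infdist b C + dist a b" by (rule infdist_triangle)
          also have "infdist b C \<le> 1 / real (2 * n + s + 1)" using b by (simp add: ring_def)
          finally show "?d \<le> dist a b" by simp
        qed
      qed
      also have "\<dots> = \<mu> (\<Union>k<Suc n. ring (2 * k + s))"
        by (simp add: lessThan_Suc Un_commute)
      finally show ?case .
    qed (use pos in \<open>simp add: positive_def\<close>)
    have ring_bound: "(\<Sum>k. \<mu> (ring k)) \<le> \<mu> T + \<mu> T"
    proof (rule suminf_le_const)
      fix n
      have "(\<Sum>k<n. \<mu> (ring k)) \<le> (\<Sum>k<2 * n. \<mu> (ring k))"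
        by (intro sum_mono2) auto
      also have "\<dots> = (\<Sum>k<n. \<mu> (ring (2 * k + 0))) + (\<Sum>k<n. \<mu> (ring (2 * k + 1)))"
        by (induction n) (auto simp: algebra_simps)
      also have "\<dots> \<le> \<mu> T + \<mu> T"
        by (intro add_mono order_trans[OF ring_sum] inc) (auto simp: ring_def)
      finally show "(\<Sum>k<n. \<mu> (ring k)) \<le> \<mu> T + \<mu> T" .
    qed simp
    then have finite: "(\<Sum>k. \<mu> (ring k)) \<noteq> top"
      using False by (auto simp: top_unique)
    \<comment> \<open>\<open>T - C\<close> is covered by \<open>far n\<close>, which is separated
      from \<open>C\<close>, and the shells from \<open>n\<close> on. Adding the first
      \<open>n\<close> shells to both sides completes the tail to the whole series, so no
      subtraction in \<open>ennreal\<close> is needed; the limit in \<open>n\<close> and one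
      cancellation finish.\<close>
    have "(\<Sum>k<n. \<mu> (ring k)) + (\<mu> (C \<inter> T) + \<mu> (T - C)) \<le> \<mu> T + (\<Sum>k. \<mu> (ring k))" for n
    proof -
      have "T - C \<subseteq> far n \<union> (\<Union>k. ring (k + n))"
      proof
        fix x assume x: "x \<in> T - C"
        then have "0 < infdist x C"
          using \<open>closed C\<close> nonempty infdist_pos_not_in_closed by auto
        then obtain m0 where "1 / real (m0 + 1) < infdist x C"
          using nat_approx_posE[of "infdist x C"] by auto
        then have ex: "\<exists>m. 1 / real (m + 1) \<le> infdist x C" by (auto intro: less_imp_le)
        \<comment> \<open>The first threshold not exceeding \<open>infdist x C\<close>: if it comes
          after \<open>n\<close>, the point lies in shell \<open>m - 1\<close>, otherwise in
          \<open>far n\<close>.\<close>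
        define m where "m = (LEAST m. 1 / real (m + 1) \<le> infdist x C)"
        have m: "1 / real (m + 1) \<le> infdist x C"
          unfolding m_def using ex by (rule LeastI_ex)
        have min: "infdist x C < 1 / real (k + 1)" if "k < m" for k
          using not_less_Least[of k "\<lambda>m. 1 / real (m + 1) \<le> infdist x C"] that
          unfolding m_def by auto
        show "x \<in> far n \<union> (\<Union>k. ring (k + n))"
        proof (cases "n < m")
          case True
          then obtain k where k: "m = k + n + 1"
            using less_imp_Suc_add[of n m] by (auto simp: ac_simps)
          then have "x \<in> ring (k + n)"
            using m min[of "k + n"] x unfolding ring_def by (auto simp: add_ac)
          then show ?thesis by auto
        next
          case False
          then have "1 / real (n + 1) \<le> 1 / real (m + 1)" by (auto simp: field_simps)
          then show ?thesis using m x unfolding far_def by auto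
        qed
      qed
      then have "\<mu> (T - C) \<le> \<mu> (far n) + \<mu> (\<Union>k. ring (k + n))"
        by (rule order_trans[OF inc sub])
      also have "\<mu> (\<Union>k. ring (k + n)) \<le> (\<Sum>k. \<mu> (ring (k + n)))"
      proof (rule csub')
        show "disjoint_family (\<lambda>k. ring (k + n))"
        proof -
          have "j \<le> i" if "x \<in> ring i" "x \<in> ring j" for x i j
          proof -
            have "1 / real (i + 2) < 1 / real (j + 1)"
              using that by (auto simp: ring_def)
            then have "real j < real i + 1" by (simp add: field_simps)
            then show ?thesis by linarith
          qed
          then show ?thesis
            by (auto simp: disjoint_family_on_def) (meson add_right_cancel antisym)
        qed
      qed
      finally have "\<mu> (T - C) \<le> \<mu> (far n) + (\<Sum>k. \<mu> (ring (k + n)))" 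
        by (simp add: add_left_mono)
      then have "(\<Sum>k<n. \<mu> (ring k)) + (\<mu> (C \<inter> T) + \<mu> (T - C))
        \<le> (\<Sum>k<n. \<mu> (ring k)) + (\<mu> (C \<inter> T) + (\<mu> (far n) + (\<Sum>k. \<mu> (ring (k + n)))))"
        by (intro add_left_mono)
      also have "\<dots> = (\<mu> (C \<inter> T) + \<mu> (far n)) + (\<Sum>k. \<mu> (ring k))"
        by (subst suminf_offset[of "\<lambda>k. \<mu> (ring k)" n]) (auto simp: ac_simps)
      also have "\<mu> (C \<inter> T) + \<mu> (far n) \<le> \<mu> (C \<inter> T \<union> far n)"
      proof (rule separated)
        show "0 < 1 / real (n + 1)" by simp
        show "1 / real (n + 1) \<le> dist a b" if "a \<in> C \<inter> T" "b \<in> far n" for a b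
          using that infdist_le[of a C b] by (auto simp: far_def dist_commute)
      qed
      also have "\<mu> (C \<inter> T \<union> far n) \<le> \<mu> T"
        by (intro inc) (auto simp: far_def)
      finally show ?thesis by (simp add: add_right_mono)
    qed
    then have "(\<Sum>k. \<mu> (ring k)) + (\<mu> (C \<inter> T) + \<mu> (T - C)) \<le> \<mu> T + (\<Sum>k. \<mu> (ring k))"
      by (rule ennreal_suminf_bound_add)
    then have "(\<Sum>k. \<mu> (ring k)) + (\<mu> (C \<inter> T) + \<mu> (T - C)) \<le> (\<Sum>k. \<mu> (ring k)) + \<mu> T"
      by (simp add: add.commute)
    then have "\<mu> (C \<inter> T) + \<mu> (T - C) \<le> \<mu> T"
      using finite by (subst (asm) ennreal_add_left_cancel_le) auto
    moreover have "(UNIV - C) \<inter> T = T - C" by auto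
    ultimately show ?thesis by simp
  qed
  moreover have "\<mu> T \<le> \<mu> (C \<inter> T) + \<mu> ((UNIV - C) \<inter> T)" for T
  proof -
    have "(C \<inter> T) \<union> ((UNIV - C) \<inter> T) = T" by auto
    then show ?thesis using sub[of "C \<inter> T" "(UNIV - C) \<inter> T"] by simp
  qed
  ultimately show ?thesis
    by (auto simp: lambda_system_def intro: antisym)
qed

section \<open>From the size-\<delta> approximations to a Borel measure\<close>

lemma hausdorff1_pre_le:
  assumes "A \<subseteq> (\<Union>i. U i)" "\<And>i. bounded (U i)" "\<And>i. diameter (U i) \<le> \<delta>"
  shows "hausdorff1_pre \<delta> A \<le> (\<Sum>i. ennreal (diameter (U i)))"
  unfolding hausdorff1_pre_def using assms by (intro INF_lower) auto

lemma hausdorff1_pre_antimono_delta: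
  assumes "\<delta> \<le> \<epsilon>" shows "hausdorff1_pre \<epsilon> A \<le> hausdorff1_pre \<delta> A"
  unfolding hausdorff1_pre_def using assms by (intro INF_superset_mono) (auto intro: order_trans)

lemma hausdorff1_pre_mono:
  assumes "A \<subseteq> B" shows "hausdorff1_pre \<delta> A \<le> hausdorff1_pre \<delta> B"
  unfolding hausdorff1_pre_def using assms by (intro INF_superset_mono) auto

text \<open>Covers of the \<open>A n\<close> that are optimal up to \<open>e / 2 ^ (n + 1)\<close>
  are merged into one sequence by \<open>prod_decode\<close>. The series may be assumed finite, so
  each infimum is strictly below its perturbed value and such covers exist.\<close>

lemma hausdorff1_pre_countably_subadditive:
  "hausdorff1_pre \<delta> (\<Union>i::nat. A i) \<le> (\<Sum>i. hausdorff1_pre \<delta> (A i))"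
proof (rule ennreal_le_epsilon)
  fix e :: real assume "0 < e" and fin: "(\<Sum>i. hausdorff1_pre \<delta> (A i)) < top"
  have "\<exists>U. A n \<subseteq> (\<Union>i. U i) \<and> (\<forall>i. bounded (U i) \<and> diameter (U i) \<le> \<delta>) \<and>
      (\<Sum>i. ennreal (diameter (U i))) \<le> hausdorff1_pre \<delta> (A n) + e * (1/2)^(Suc n)" for n
  proof -
    have "hausdorff1_pre \<delta> (A n) < hausdorff1_pre \<delta> (A n) + e * (1/2)^(Suc n)"
      using fin \<open>0 < e\<close> by (auto simp add: less_top dest!: ennreal_suminf_lessD)
    then show ?thesis
      unfolding hausdorff1_pre_def[of \<delta> "A n"] by (subst (asm) INF_less_iff) (auto intro: less_imp_le)
  qed
  then obtain U where U: "\<And>n. A n \<subseteq> (\<Union>i. U n i)" "\<And>n i. bounded (U n i)" "\<And>n i. diameter (U n i) \<le> \<delta>"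
    "\<And>n. (\<Sum>i. ennreal (diameter (U n i))) \<le> hausdorff1_pre \<delta> (A n) + e * (1/2)^(Suc n)"
    by metis
  have "hausdorff1_pre \<delta> (\<Union>i. A i) \<le> (\<Sum>k. ennreal (diameter (case_prod U (prod_decode k))))"
  proof (rule hausdorff1_pre_le)
    show "(\<Union>i. A i) \<subseteq> (\<Union>k. case_prod U (prod_decode k))"
      using U(1) by (fastforce intro: exI[of _ "prod_encode _"] simp: subset_eq) 
  qed (auto simp: U split: prod.split)
  also have "\<dots> = (\<Sum>n. \<Sum>i. ennreal (diameter (U n i)))"
    using suminf_ennreal_2dimen[of "\<lambda>n. \<Sum>i. ennreal (diameter (U n i))"
        "\<lambda>p. ennreal (diameter (case_prod U p))"] by simp
  also have "\<dots> \<le> (\<Sum>n. hausdorff1_pre \<delta> (A n) + e * (1/2) ^ Suc n)"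
    by (intro suminf_le U) auto
  also have "\<dots> = (\<Sum>n. hausdorff1_pre \<delta> (A n)) + (\<Sum>n. ennreal e * ennreal ((1/2) ^ Suc n))"
    using \<open>0 < e\<close> by (subst suminf_add[symmetric])
      (auto simp del: ennreal_suminf_cmult simp add: ennreal_mult[symmetric])
  also have "\<dots> = (\<Sum>n. hausdorff1_pre \<delta> (A n)) + e"
    unfolding ennreal_suminf_cmult
    by (subst suminf_ennreal_eq[OF zero_le_power power_half_series]) auto
  finally show "hausdorff1_pre \<delta> (\<Union>i. A i) \<le> (\<Sum>n. hausdorff1_pre \<delta> (A n)) + e" .
qed

text \<open>A set of diameter at most \<delta> cannot meet both \<open>A\<close> and
  \<open>B\<close>, so every cover of the union splits into covers of \<open>A\<close> and of
  \<open>B\<close> that share no nonempty set.\<close>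

lemma hausdorff1_pre_separated:
  assumes "\<delta> < d" and sep: "\<And>a b. a \<in> A \<Longrightarrow> b \<in> B \<Longrightarrow> d \<le> dist a b"
  shows "hausdorff1_pre \<delta> A + hausdorff1_pre \<delta> B \<le> hausdorff1_pre \<delta> (A \<union> B)"
  unfolding hausdorff1_pre_def[of \<delta> "A \<union> B"]
proof (rule INF_greatest, clarify)
  fix U :: "nat \<Rightarrow> 'a set"
  assume cover: "A \<union> B \<subseteq> (\<Union>i. U i)" and U: "\<forall>i. bounded (U i) \<and> diameter (U i) \<le> \<delta>"
  \<comment> \<open>Discarded sets become empty, which keeps the index set and costs nothing because
    the empty set has diameter 0. That they are admissible requires
    \<open>0 \<le> \<delta>\<close>.\<close>
  define V where "V C i = (if U i \<inter> C = {} then {} else U i)" for C i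
  have nonneg: "0 \<le> \<delta>"
    using U diameter_ge_0 order_trans by blast
  have le: "hausdorff1_pre \<delta> C \<le> (\<Sum>i. ennreal (diameter (V C i)))" if "C \<subseteq> A \<union> B" for C
  proof (rule hausdorff1_pre_le)
    show "C \<subseteq> (\<Union>i. V C i)"
      using that cover by (fastforce simp: V_def)
  qed (use U nonneg in \<open>auto simp: V_def\<close>)
  have "hausdorff1_pre \<delta> A + hausdorff1_pre \<delta> B
    \<le> (\<Sum>i. ennreal (diameter (V A i)) + ennreal (diameter (V B i)))"
    using add_mono[OF le[of A] le[of B]] by (simp add: suminf_add)
  also have "\<dots> \<le> (\<Sum>i. ennreal (diameter (U i)))"
  proof (intro suminf_le)
    fix i
    have "U i \<inter> A = {} \<or> U i \<inter> B = {}"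
    proof (rule ccontr)
      assume "\<not> ?thesis"
      then obtain a b where ab: "a \<in> U i" "a \<in> A" "b \<in> U i" "b \<in> B" by auto
      then have "dist a b \<le> \<delta>"
        using U diameter_bounded_bound[of "U i" a b] by (meson order_trans)
      then show False using sep[OF ab(2,4)] assms(1) by simp
    qed
    then show "ennreal (diameter (V A i)) + ennreal (diameter (V B i)) \<le> ennreal (diameter (U i))"
      by (auto simp: V_def)
  qed auto
  finally show "hausdorff1_pre \<delta> A + hausdorff1_pre \<delta> B \<le> (\<Sum>i. ennreal (diameter (U i)))" .
qed

lemma hausdorff1_outer_mono: "A \<subseteq> B \<Longrightarrow> hausdorff1_outer A \<le> hausdorff1_outer B"
  unfolding hausdorff1_outer_def by (intro SUP_mono') (rule hausdorff1_pre_mono)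

text \<open>The approximations grow as \<delta> decreases, so the two suprema can be taken
  simultaneously, and only scales below \<open>d\<close> matter, where the previous splitting
  applies.\<close>

lemma hausdorff1_outer_separated:
  assumes "0 < d" and sep: "\<And>a b. a \<in> A \<Longrightarrow> b \<in> B \<Longrightarrow> d \<le> dist a b"
  shows "hausdorff1_outer A + hausdorff1_outer B \<le> hausdorff1_outer (A \<union> B)"
proof -
  have "hausdorff1_outer A + hausdorff1_outer B
    = (SUP \<delta> \<in> {0<..}. hausdorff1_pre \<delta> A + hausdorff1_pre \<delta> B)"
    unfolding hausdorff1_outer_def
  proof (rule SUP_add_directed_ennreal[symmetric])
    fix \<delta> \<epsilon> :: real assume "\<delta> \<in> {0<..}" "\<epsilon> \<in> {0<..}"
    then show "\<exists>\<eta>\<in>{0<..}. hausdorff1_pre \<delta> A + hausdorff1_pre \<epsilon> B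
        \<le> hausdorff1_pre \<eta> A + hausdorff1_pre \<eta> B"
      by (intro bexI[of _ "min \<delta> \<epsilon>"] add_mono hausdorff1_pre_antimono_delta) auto
  qed
  also have "\<dots> \<le> hausdorff1_outer (A \<union> B)"
  proof (rule SUP_least)
    fix \<delta> :: real assume \<delta>: "\<delta> \<in> {0<..}"
    let ?\<epsilon> = "min \<delta> (d / 2)"
    have "hausdorff1_pre \<delta> A + hausdorff1_pre \<delta> B \<le> hausdorff1_pre ?\<epsilon> A + hausdorff1_pre ?\<epsilon> B"
      by (intro add_mono hausdorff1_pre_antimono_delta) auto
    also have "\<dots> \<le> hausdorff1_pre ?\<epsilon> (A \<union> B)"
      using assms by (intro hausdorff1_pre_separated[where d = d]) auto
    also have "\<dots> \<le> hausdorff1_outer (A \<union> B)"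
      unfolding hausdorff1_outer_def using \<delta> assms(1) by (intro SUP_upper) auto
    finally show "hausdorff1_pre \<delta> A + hausdorff1_pre \<delta> B \<le> hausdorff1_outer (A \<union> B)" .
  qed
  finally show ?thesis .
qed

lemma outer_measure_space_hausdorff1:
  "outer_measure_space UNIV (hausdorff1_outer :: 'a::metric_space set \<Rightarrow> ennreal)"
  unfolding outer_measure_space_def
proof (intro conjI)
  have "hausdorff1_outer ({} :: 'a set) \<le> 0"
    unfolding hausdorff1_outer_def
  proof (rule SUP_least)
    fix \<delta> :: real assume "\<delta> \<in> {0<..}"
    then show "hausdorff1_pre \<delta> ({} :: 'a set) \<le> 0"
      using hausdorff1_pre_le[of "{} :: 'a set" "\<lambda>_. {}" \<delta>] by simp
  qed
  then show "positive UNIV (hausdorff1_outer :: 'a set \<Rightarrow> ennreal)"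
    by (simp add: positive_def)
  show "increasing UNIV (hausdorff1_outer :: 'a set \<Rightarrow> ennreal)"
    by (auto simp: increasing_def intro: hausdorff1_outer_mono)
  show "countably_subadditive UNIV (hausdorff1_outer :: 'a set \<Rightarrow> ennreal)"
    unfolding countably_subadditive_def
  proof (intro allI impI)
    fix A :: "nat \<Rightarrow> 'a set"
    show "hausdorff1_outer (\<Union>i. A i) \<le> (\<Sum>i. hausdorff1_outer (A i))"
      unfolding hausdorff1_outer_def[of "\<Union>i. A i"]
    proof (rule SUP_least)
      fix \<delta> :: real assume \<delta>: "\<delta> \<in> {0<..}"
      have "hausdorff1_pre \<delta> (\<Union>i. A i) \<le> (\<Sum>i. hausdorff1_pre \<delta> (A i))"
        by (rule hausdorff1_pre_countably_subadditive)
      also have "\<dots> \<le> (\<Sum>i. hausdorff1_outer (A i))"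
        unfolding hausdorff1_outer_def using \<delta> by (intro suminf_le SUP_upper) auto
      finally show "hausdorff1_pre \<delta> (\<Union>i. A i) \<le> (\<Sum>i. hausdorff1_outer (A i))" .
    qed
  qed
qed

text \<open>The Caratheodory-measurable sets form a sigma-algebra containing the closed sets, hence
  all Borel sets.\<close>

lemma measure_space_hausdorff1:
  "measure_space UNIV (sets borel) (hausdorff1_outer :: 'a::metric_space set \<Rightarrow> ennreal)"
proof -
  let ?L = "lambda_system UNIV UNIV (hausdorff1_outer :: 'a set \<Rightarrow> ennreal)"
  have L: "measure_space UNIV ?L (hausdorff1_outer :: 'a set \<Rightarrow> ennreal)"
    using sigma_algebra.caratheodory_lemma[OF sigma_algebra_Pow[of UNIV]]
      outer_measure_space_hausdorff1 by auto
  have "sets borel \<subseteq> ?L"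
  proof -
    have "{C :: 'a set. closed C} \<subseteq> ?L"
      using metric_outer_measure_closed[OF outer_measure_space_hausdorff1] hausdorff1_outer_separated
      by blast
    then have "sigma_sets UNIV {C :: 'a set. closed C} \<subseteq> ?L"
      using L by (intro sigma_algebra.sigma_sets_subset) (simp_all add: measure_space_def)
    then show ?thesis by (simp add: borel_eq_closed)
  qed
  then show ?thesis
    using L sets.sigma_algebra_axioms[of "borel :: 'a measure"] by (auto intro: measure_down)
qed

section \<open>The measure \<open>hausdorff1\<close> and its values on a line\<close>

lemma sets_hausdorff1 [simp, measurable_cong]: "sets hausdorff1 = sets borel"
  unfolding hausdorff1_def using sets.sigma_sets_eq[of borel] by (simp add: sets_measure_of_conv)

lemma space_hausdorff1 [simp]: "space hausdorff1 = UNIV"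
  by (simp add: hausdorff1_def space_measure_of_conv)

lemma emeasure_hausdorff1:
  assumes "A \<in> sets borel" shows "emeasure hausdorff1 A = hausdorff1_outer A"
proof (rule emeasure_measure_of[OF hausdorff1_def])
  show "positive (sets hausdorff1) hausdorff1_outer" "countably_additive (sets hausdorff1) hausdorff1_outer"
    using measure_space_hausdorff1 by (auto simp: measure_space_def)
qed (use assms in auto)

text \<open>From above, the segment is cut into equal pieces shorter than \<delta>. From below, any
  cover projects into intervals of the same diameters, and countable subadditivity of Lebesgue
  measure bounds their total length. The intervals replace the projections themselves, which need
  not be measurable.\<close>

lemma hausdorff1_outer_segment:
  fixes e :: "'a::real_inner"
  assumes e: "norm e = 1" and lu: "l \<le> u"
  shows "hausdorff1_outer ((\<lambda>t. t *\<^sub>R e) ` {l<..<u}) = ennreal (u - l)"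
proof (rule antisym)
  show "hausdorff1_outer ((\<lambda>t. t *\<^sub>R e) ` {l<..<u}) \<le> ennreal (u - l)"
    unfolding hausdorff1_outer_def
  proof (rule SUP_least)
    fix \<delta> :: real assume "\<delta> \<in> {0<..}"
    then have \<delta>: "0 < \<delta>" by simp
    obtain n :: nat where "(u - l) / \<delta> < real n" using reals_Archimedean2 by blast
    moreover from this have n: "0 < n"
      using \<delta> lu by (cases n) (auto simp: field_simps)
    ultimately have h: "(u - l) / real n \<le> \<delta>"
      using \<delta> by (simp add: field_simps)
    define h where "h = (u - l) / real n"
    have h0: "0 \<le> h" using lu by (simp add: h_def)
    define U where "U i = (if i < n then (\<lambda>t. t *\<^sub>R e) ` {l + real i * h..l + (real i + 1) * h} else {})" for i
    have bnd: "dist x y \<le> h" if "x \<in> U i" "y \<in> U i" for x y i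
    proof -
      from that obtain s t where "x = s *\<^sub>R e" "y = t *\<^sub>R e"
        "s \<in> {l + real i * h..l + (real i + 1) * h}" "t \<in> {l + real i * h..l + (real i + 1) * h}"
        unfolding U_def by (auto split: if_splits simp del: atLeastAtMost_iff)
      then show ?thesis
        using e by (auto simp: dist_norm algebra_simps abs_le_iff simp flip: scaleR_diff_left)
    qed
    have dia: "diameter (U i) \<le> h" for i
      using bnd h0 by (intro diameter_le) (auto simp: dist_norm)
    have "hausdorff1_pre \<delta> ((\<lambda>t. t *\<^sub>R e) ` {l<..<u}) \<le> (\<Sum>i. ennreal (diameter (U i)))"
    proof (rule hausdorff1_pre_le)
      show "bounded (U i)" for i using bnd bounded_two_points by blast
      show "diameter (U i) \<le> \<delta>" for i using dia[of i] h by (simp add: h_def)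
      show "(\<lambda>t. t *\<^sub>R e) ` {l<..<u} \<subseteq> (\<Union>i. U i)"
      proof clarify
        fix t assume t: "t \<in> {l<..<u}"
        \<comment> \<open>A point of the open segment exists, so \<open>l < u\<close> and the
          division by \<open>h\<close> is legitimate.\<close>
        then have hpos: "0 < h" using n by (simp add: h_def)
        define i where "i = nat \<lfloor>(t - l) / h\<rfloor>"
        have i: "real i \<le> (t - l) / h" "(t - l) / h < real i + 1"
          using t hpos by (auto simp: i_def)
        have "(t - l) / h < real n" using t n hpos by (simp add: h_def field_simps)
        with i have "i < n" by linarith
        moreover have "t \<in> {l + real i * h..l + (real i + 1) * h}"
          using i hpos by (auto simp: field_simps)
        ultimately have "t *\<^sub>R e \<in> U i" unfolding U_def by (simp only: if_True) (rule imageI)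
        then show "t *\<^sub>R e \<in> (\<Union>i. U i)" by blast
      qed
    qed
    also have "\<dots> = (\<Sum>i<n. ennreal (diameter (U i)))"
      by (intro suminf_finite) (auto simp: U_def)
    also have "\<dots> \<le> (\<Sum>i<n. ennreal h)"
      using dia by (intro sum_mono ennreal_leI)
    also have "\<dots> = ennreal (u - l)"
      using n h0 by (simp add: h_def ennreal_of_nat_eq_real_of_nat flip: ennreal_mult)
    finally show "hausdorff1_pre \<delta> ((\<lambda>t. t *\<^sub>R e) ` {l<..<u}) \<le> ennreal (u - l)" .
  qed
next
  \<comment> \<open>Any single scale bounds the supremum from below; the value 1 is
    arbitrary.\<close>
  have "ennreal (u - l) \<le> hausdorff1_pre 1 ((\<lambda>t. t *\<^sub>R e) ` {l<..<u})"
    unfolding hausdorff1_pre_def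
  proof (rule INF_greatest, clarify)
    fix U :: "nat \<Rightarrow> 'a set"
    assume cover: "(\<lambda>t. t *\<^sub>R e) ` {l<..<u} \<subseteq> (\<Union>i. U i)"
      and U: "\<forall>i. bounded (U i) \<and> diameter (U i) \<le> 1"
    \<comment> \<open>Orthogonal projection to the line does not increase diameters.\<close>
    define J where "J i = {Sup ((\<lambda>x. x \<bullet> e) ` U i) - diameter (U i)..Sup ((\<lambda>x. x \<bullet> e) ` U i)}" for i
    have J: "x \<bullet> e \<in> J i" if x: "x \<in> U i" for x i
    proof -
      have le: "y \<bullet> e \<le> x \<bullet> e + diameter (U i)" if "y \<in> U i" "x \<in> U i" for x y
      proof -
        have "(y - x) \<bullet> e \<le> norm (y - x) * norm e" by (rule norm_cauchy_schwarz)
        also have "\<dots> \<le> diameter (U i)"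
          using diameter_bounded_bound[of "U i" y x] that U e by (simp add: dist_norm)
        finally show ?thesis by (simp add: inner_diff_left)
      qed
      have "bdd_above ((\<lambda>x. x \<bullet> e) ` U i)"
        using le[OF _ x] by (intro bdd_aboveI) auto
      then have "x \<bullet> e \<le> Sup ((\<lambda>x. x \<bullet> e) ` U i)"
        using x by (intro cSup_upper) auto
      moreover have "Sup ((\<lambda>x. x \<bullet> e) ` U i) \<le> x \<bullet> e + diameter (U i)"
        using x le by (intro cSup_least) auto
      ultimately show ?thesis by (simp add: J_def)
    qed
    have "{l<..<u} \<subseteq> (\<Union>i. J i)"
    proof
      fix t assume "t \<in> {l<..<u}"
      then obtain i where "t *\<^sub>R e \<in> U i" using cover by blast
      from J[OF this] show "t \<in> (\<Union>i. J i)"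
        using e by (auto simp: dot_square_norm)
    qed
    have "ennreal (u - l) = emeasure lborel {l<..<u}" using lu by simp
    also have "\<dots> \<le> emeasure lborel (\<Union>i. J i)"
      by (intro emeasure_mono) (auto simp: J_def \<open>{l<..<u} \<subseteq> (\<Union>i. J i)\<close>[unfolded J_def])
    also have "\<dots> \<le> (\<Sum>i. emeasure lborel (J i))"
      by (intro emeasure_subadditive_countably) (auto simp: J_def)
    also have "\<dots> = (\<Sum>i. ennreal (diameter (U i)))"
      using U by (simp add: J_def diameter_ge_0)
    finally show "ennreal (u - l) \<le> (\<Sum>i. ennreal (diameter (U i)))" .
  qed
  also have "\<dots> \<le> hausdorff1_outer ((\<lambda>t. t *\<^sub>R e) ` {l<..<u})"
    unfolding hausdorff1_outer_def by (intro SUP_upper) auto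
  finally show "ennreal (u - l) \<le> hausdorff1_outer ((\<lambda>t. t *\<^sub>R e) ` {l<..<u})" .
qed

text \<open>On the line, \<open>x \<bullet> e\<close> inverts \<open>t *\<^sub>R e\<close>. Its
  image measure agrees with \<open>lborel\<close> on open intervals by the segment formula, and
  those determine \<open>lborel\<close>.\<close>

lemma set_integral_hausdorff1_line:
  fixes e :: "'a::{real_inner, second_countable_topology}" and f :: "'a \<Rightarrow> real"
  assumes e: "norm e = 1" and f [measurable]: "f \<in> borel_measurable borel"
  shows "(LINT x:range (\<lambda>t. t *\<^sub>R e)|hausdorff1. f x) = (LBINT t. f (t *\<^sub>R e))"
proof -
  let ?S = "range (\<lambda>t. t *\<^sub>R e)" and ?T = "\<lambda>x. x \<bullet> e"
  have S_eq: "?S = {x. x - (x \<bullet> e) *\<^sub>R e = 0}"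
    using e by (auto simp: dot_square_norm)
  have "closed ?S"
    unfolding S_eq by (intro closed_Collect_eq continuous_intros)
  then have S: "?S \<in> sets borel" by simp
  have "lborel = distr (restrict_space hausdorff1 ?S) borel ?T"
  proof (rule lborel_eqI)
    fix l u :: real assume "\<And>b. b \<in> Basis \<Longrightarrow> l \<bullet> b \<le> u \<bullet> b"
    then have lu: "l \<le> u" by simp
    have eq: "?T -` {l<..<u} \<inter> ?S = (\<lambda>t. t *\<^sub>R e) ` {l<..<u}"
      using e by (auto simp: norm_eq_1)
    have "?T -` box l u \<in> sets borel" 
      using measurable_sets[of ?T borel borel "box l u"] by simp
    then have m: "?T -` box l u \<inter> ?S \<in> sets borel" using S by auto
    have "emeasure (distr (restrict_space hausdorff1 ?S) borel ?T) (box l u)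
      = emeasure (restrict_space hausdorff1 ?S) (?T -` box l u \<inter> ?S)"
      by (subst emeasure_distr) (auto simp: space_restrict_space intro!: measurable_restrict_space1)
    also have "\<dots> = hausdorff1_outer ((\<lambda>t. t *\<^sub>R e) ` {l<..<u})"
      using S m by (subst emeasure_restrict_space) (auto simp: emeasure_hausdorff1 eq)
    also have "\<dots> = ennreal (\<Prod>b\<in>Basis. (u - l) \<bullet> b)"
      using hausdorff1_outer_segment[OF e lu] by simp
    finally show "emeasure (distr (restrict_space hausdorff1 ?S) borel ?T) (box l u)
      = ennreal (\<Prod>b\<in>Basis. (u - l) \<bullet> b)" .
  qed simp
  then have "(LBINT t. f (t *\<^sub>R e)) = (LINT t|distr (restrict_space hausdorff1 ?S) borel ?T. f (t *\<^sub>R e))"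
    by simp
  also have "\<dots> = (LINT x|restrict_space hausdorff1 ?S. f ((x \<bullet> e) *\<^sub>R e))"
    by (intro integral_distr) (auto intro!: measurable_restrict_space1)
  also have "\<dots> = (LINT x|restrict_space hausdorff1 ?S. f x)"
    by (intro Bochner_Integration.integral_cong) (auto simp: space_restrict_space dot_square_norm e)
  also have "\<dots> = (LINT x:?S|hausdorff1. f x)"
    using S by (subst integral_restrict_space) (auto simp: set_lebesgue_integral_def)
  finally show ?thesis by simp
qed

section \<open>The formula for Phi\<close>

definition rot :: "real^2 \<Rightarrow> real^2" where
  "rot x = vector [- (x $ 2), x $ 1]"

lemma rot_nth [simp]: "rot x $ 1 = - (x $ 2)" "rot x $ 2 = x $ 1"
  by (simp_all add: rot_def)

lemma linear_rot: "linear rot"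
  by (intro linearI) (auto simp: vec_eq_iff forall_2)

lemma rot_rot [simp]: "rot (rot x) = - x"
  by (simp add: vec_eq_iff forall_2)

lemma inner_rot [simp]: "rot x \<bullet> rot y = x \<bullet> y"
  by (simp add: inner_vec_def sum_2)

lemma norm_rot [simp]: "norm (rot x) = norm x"
  by (simp add: norm_eq_sqrt_inner)

lemma inner_rot_self [simp]: "x \<bullet> rot x = 0" "rot x \<bullet> x = 0"
  by (simp_all add: inner_vec_def sum_2)

lemma orthogonal_line_eq_range_rot:
  assumes [simp]: "p \<noteq> 0"
  shows "{x. x \<bullet> p = 0} = range (\<lambda>t. t *\<^sub>R (rot p /\<^sub>R norm p))"
proof (intro equalityI subsetI)
  fix x assume "x \<in> {x. x \<bullet> p = 0}"
  then have x: "x $ 1 * p $ 1 + x $ 2 * p $ 2 = 0" by (simp add: inner_vec_def sum_2)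
  have p: "(norm p)\<^sup>2 = (p $ 1)\<^sup>2 + (p $ 2)\<^sup>2"
    unfolding power2_norm_eq_inner by (simp add: inner_vec_def sum_2 power2_eq_square)
  \<comment> \<open>The coefficient \<open>x $ 2 * p $ 1 - x $ 1 * p $ 2\<close> is
    \<open>x \<bullet> rot p\<close>, so this is the projection of \<open>x\<close> onto
    \<open>rot p\<close>, cleared of denominators.\<close>
  have "x $ 1 * (norm p)\<^sup>2 = (x $ 2 * p $ 1 - x $ 1 * p $ 2) * - (p $ 2)"
    "x $ 2 * (norm p)\<^sup>2 = (x $ 2 * p $ 1 - x $ 1 * p $ 2) * p $ 1"
    unfolding p using x by algebra+
  then have "x $ 1 = (x $ 2 * p $ 1 - x $ 1 * p $ 2) * - (p $ 2) / (norm p)\<^sup>2"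
    "x $ 2 = (x $ 2 * p $ 1 - x $ 1 * p $ 2) * p $ 1 / (norm p)\<^sup>2"
    by (intro eq_divide_imp; simp)+
  then have "x = ((x $ 2 * p $ 1 - x $ 1 * p $ 2) / norm p) *\<^sub>R (rot p /\<^sub>R norm p)"
    unfolding vec_eq_iff forall_2 by (simp add: power2_eq_square divide_inverse mult_ac)
  then show "x \<in> range (\<lambda>t. t *\<^sub>R (rot p /\<^sub>R norm p))" by blast
qed auto

section \<open>Norms as functions, and the integral defining \<open>Phi\<close>\<close>

lemma is_norm_nonneg: "is_norm N \<Longrightarrow> 0 \<le> N x"
  and is_norm_eq_0: "is_norm N \<Longrightarrow> N x = 0 \<longleftrightarrow> x = 0"
  and is_norm_scaleR: "is_norm N \<Longrightarrow> N (c *\<^sub>R x) = \<bar>c\<bar> * N x"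
  and is_norm_triangle: "is_norm N \<Longrightarrow> N (x + y) \<le> N x + N y"
  by (auto simp: is_norm_def)

lemma is_norm_minus: "is_norm N \<Longrightarrow> N (- x) = N x"
  using is_norm_scaleR[of N "-1" x] by simp

lemma is_norm_lipschitz:
  fixes N :: "'a::euclidean_space \<Rightarrow> real"
  assumes N: "is_norm N"
  obtains K where "0 < K" "\<And>x y. \<bar>N x - N y\<bar> \<le> K * norm (x - y)"
proof -
  \<comment> \<open>The summand 1 makes \<open>K\<close> positive, so that it can later serve as a
    divisor.\<close>
  define K where "K = 1 + (\<Sum>b\<in>Basis. N b)"
  have sum_le: "N (\<Sum>b\<in>B. f b) \<le> (\<Sum>b\<in>B. N (f b))" if "finite B" for f :: "'a \<Rightarrow> 'a" and B
    using that
  proof (induction B rule: finite_induct)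
    case empty
    then show ?case using is_norm_eq_0[OF N, of 0] by simp
  next
    case (insert b B)
    then show ?case using is_norm_triangle[OF N, of "f b" "\<Sum>b\<in>B. f b"] by simp
  qed
  have K1: "1 \<le> K"
    unfolding K_def using is_norm_nonneg[OF N] by (simp add: sum_nonneg)
  have le: "N x \<le> K * norm x" for x
  proof -
    have "N x = N (\<Sum>b\<in>Basis. (x \<bullet> b) *\<^sub>R b)" by (simp add: euclidean_representation)
    also have "\<dots> \<le> (\<Sum>b\<in>Basis. N ((x \<bullet> b) *\<^sub>R b))" by (rule sum_le) simp
    also have "\<dots> \<le> (\<Sum>b\<in>Basis. norm x * N b)"
      by (intro sum_mono) (auto simp: is_norm_scaleR[OF N] Basis_le_norm intro!: mult_right_mono is_norm_nonneg[OF N])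
    also have "\<dots> \<le> K * norm x"
      by (simp add: K_def algebra_simps sum_distrib_left)
    finally show ?thesis .
  qed
  have "\<bar>N x - N y\<bar> \<le> K * norm (x - y)" for x y
    using is_norm_triangle[OF N, of "x - y" y] is_norm_triangle[OF N, of "y - x" x]
      le[of "x - y"] le[of "y - x"] by (simp add: norm_minus_commute)
  then show ?thesis using that[of K] K1 le by auto
qed

lemma is_norm_continuous:
  fixes N :: "'a::euclidean_space \<Rightarrow> real"
  assumes N: "is_norm N"
  shows "continuous_on S N"
proof -
  obtain K where "0 < K" "\<And>x y. \<bar>N x - N y\<bar> \<le> K * norm (x - y)"
    using is_norm_lipschitz[OF N] by metis
  then have "K-lipschitz_on S N"
    by (intro lipschitz_onI) (auto simp: dist_norm)
  then show ?thesis by (rule lipschitz_on_continuous_on)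
qed

lemma lborel_integral_even:
  fixes f :: "real \<Rightarrow> real"
  assumes int: "set_integrable lborel {0..} f" and even: "\<And>t. f (- t) = f t"
  shows "(LBINT t. f t) = 2 * (LBINT t:{0..}. f t)"
proof -
  have null: "AE t in lborel. t \<noteq> (0::real)" by (rule AE_lborel_singleton)
  have pos: "integrable lborel (\<lambda>t. indicator {0..} t * f t)"
    using int by (simp add: set_integrable_def)
  have neg: "integrable lborel (\<lambda>t. indicator {0..} (- t) * f t)"
    using lborel_integrable_real_affine[OF pos, of "-1" 0] by (simp add: even)
  have neg_eq: "(LBINT t. indicator {0..} (- t) * f t) = (LBINT t. indicator {0..} t * f t)"
    using lborel_integral_real_affine[of "-1" "\<lambda>t. indicator {0..} t * f t" 0] by (simp add: even)
  have "AE t in lborel. f t = indicator {0..} t * f t + indicator {0..} (- t) * f t"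
    using null by eventually_elim (auto simp: indicator_def)
  moreover have "f \<in> borel_measurable lborel"
  proof -
    \<comment> \<open>Only the half-line restriction is known to be measurable; evenness recovers
      \<open>f\<close> from it, with 0 treated apart because both halves contain it.\<close>
    have "(\<lambda>t. if t = 0 then f 0 else indicator {0..} t * f t + indicator {0..} (- t) * f t) \<in> borel_measurable lborel"
      using pos neg by measurable
    moreover have "(\<lambda>t. if t = 0 then f 0 else indicator {0..} t * f t + indicator {0..} (- t) * f t) = f"
      by (auto simp: indicator_def fun_eq_iff)
    ultimately show ?thesis by simp
  qed
  ultimately have "(LBINT t. f t) = (LBINT t. indicator {0..} t * f t + indicator {0..} (- t) * f t)"
    using pos neg by (intro integral_cong_AE) auto
  also have "\<dots> = 2 * (LBINT t:{0..}. f t)"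
    using pos neg neg_eq by (simp add: set_lebesgue_integral_def)
  finally show ?thesis .
qed

text \<open>Along the unit vector \<open>e\<close> the integrand is the even profile
  \<open>g\<close> evaluated at \<open>N e * t\<close>, so the substitution contributes
  \<open>1 / N e\<close>. One factor 2 comes from the whole line, the other from the definition of
  \<open>Phi\<close>.\<close>

lemma Phi_eq:
  assumes N: "is_norm N" and lam: "0 < lam"
    and lam_eq: "inverse lam = (LBINT t:{0..}. 1 / (1 + t powr (2 + \<alpha>)))"
  shows "Phi \<alpha> N p = lam / 4 * N (rot p)"
proof (cases "p = 0")
  case True
  then show ?thesis using is_norm_eq_0[OF N] linear_0[OF linear_rot] by (simp add: Phi_def)
next
  case False
  define e where "e = rot p /\<^sub>R norm p"
  define g where "g t = 1 / (1 + \<bar>t\<bar> powr (2 + \<alpha>))" for t :: real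
  have e: "norm e = 1" using False by (simp add: e_def)
  then have Ne: "0 < N e" using is_norm_nonneg[OF N, of e] is_norm_eq_0[OF N, of e] by force
  have g_half: "(LBINT t:{0..}. g t) = inverse lam"
    unfolding lam_eq g_def by (rule set_lebesgue_integral_cong) auto
  \<comment> \<open>Otherwise the integral would be 0, while \<open>inverse lam\<close> is
    not.\<close>
  then have "set_integrable lborel {0..} g"
    using lam not_integrable_integral_eq[of lborel "\<lambda>t. indicator {0..} t *\<^sub>R g t"]
    by (force simp: set_integrable_def set_lebesgue_integral_def)
  moreover have "g (- t) = g t" for t by (simp add: g_def)
  ultimately have g_full: "(LBINT t. g t) = 2 / lam"
    using g_half lborel_integral_even[of g] by (simp add: divide_inverse)
  have [measurable]: "N \<in> borel_measurable borel"
    using is_norm_continuous[OF N] by (rule borel_measurable_continuous_onI)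
  have "(LINT x:{x. x \<bullet> p = 0}|hausdorff1. 1 / (1 + N x powr (2 + \<alpha>)))
      = (LBINT t. 1 / (1 + N (t *\<^sub>R e) powr (2 + \<alpha>)))"
    unfolding orthogonal_line_eq_range_rot[OF False] e_def[symmetric]
    by (rule set_integral_hausdorff1_line[OF e]) measurable
  also have "\<dots> = (LBINT t. g (0 + N e * t))"
    using Ne by (simp add: is_norm_scaleR[OF N] g_def abs_mult mult.commute)
  also have "\<dots> = (LBINT t. g t) / N e"
    using lborel_integral_real_affine[of "N e" g 0] Ne by simp
  finally have "Phi \<alpha> N p = inverse (2 * (2 / lam / N e)) * norm p"
    using False g_full by (simp add: Phi_def)
  also have "\<dots> = lam / 4 * (norm p * N e)" by simp
  also have "norm p * N e = N (rot p)"
    using False is_norm_scaleR[OF N, of "norm p" e] by (simp add: e_def)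
  finally show ?thesis .
qed

section \<open>Regularity classes under similarities\<close>

text \<open>The orthonormal frame is moved by \<open>T\<close>, the radius becomes
  \<open>c * r\<close>, and the graph function becomes \<open>c * f (t / c)\<close>, exactly the
  dilation under which \<open>R\<close> is invariant.\<close>

lemma boundary_of_class_similarity:
  assumes R: "dilation_invariant R" and T: "orthogonal_transformation T" and c: "0 < c"
    and S: "boundary_of_class R S"
  shows "boundary_of_class R ((\<lambda>x. c *\<^sub>R T x) ` S)"
  unfolding boundary_of_class_def
proof
  let ?G = "\<lambda>x. c *\<^sub>R T x"
  have linT: "linear T" and inner: "\<And>x y. T x \<bullet> T y = x \<bullet> y"
    using T by (auto simp: orthogonal_transformation_def)
  have G: "linear ?G" using linT by (rule linear_compose_scale_right)
  have injG: "inj ?G"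
    using orthogonal_transformation_inj[OF T] c by (auto simp: inj_def)
  have surjG: "surj ?G" by (rule linear_injective_imp_surjective[OF G injG refl])
  have diff: "?G y - ?G x = ?G (y - x)" for x y
    by (simp add: linear_diff[OF linT] scaleR_diff_right)
  have frontier: "frontier (?G ` S) = ?G ` frontier S"
    using closure_injective_linear_image[OF G injG] interior_injective_linear_image[OF G injG]
    by (simp add: frontier_def image_set_diff[OF injG])
  fix x' assume "x' \<in> frontier (?G ` S)"
  then obtain x where x: "x' = ?G x" "x \<in> frontier S" unfolding frontier by blast
  obtain e \<nu> r f where *: "norm e = 1" "norm \<nu> = 1" "e \<bullet> \<nu> = 0" "r > 0" "R f {-r<..<r}"
    and graph: "\<And>y. y \<in> ball x r \<Longrightarrow> y \<in> S \<longleftrightarrow> f ((y - x) \<bullet> e) \<le> (y - x) \<bullet> \<nu>"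
    using S x(2) unfolding boundary_of_class_def by metis
  show "\<exists>e \<nu> r f. norm e = 1 \<and> norm \<nu> = 1 \<and> e \<bullet> \<nu> = 0 \<and> r > 0 \<and> R f {-r<..<r} \<and>
      (\<forall>y\<in>ball x' r. y \<in> ?G ` S \<longleftrightarrow> f ((y - x') \<bullet> e) \<le> (y - x') \<bullet> \<nu>)"
  proof (intro exI conjI ballI)
    show "norm (T e) = 1" "norm (T \<nu>) = 1" "T e \<bullet> T \<nu> = 0"
      using * by (simp_all add: inner orthogonal_transformation_norm[OF T])
    show "0 < c * r" using c * by simp
    show "R (\<lambda>t. c * f (t / c)) {- (c * r)<..<c * r}"
      using R c * unfolding dilation_invariant_def by blast
    fix y' assume y': "y' \<in> ball x' (c * r)"
    obtain y where y: "y' = ?G y" using surjG by (metis surjD)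
    have "c * norm (x - y) < c * r"
      using y' c unfolding x(1) y mem_ball dist_norm diff
      by (simp add: orthogonal_transformation_norm[OF T])
    then have ball: "y \<in> ball x r" using c by (simp add: dist_norm)
    have "y' \<in> ?G ` S \<longleftrightarrow> y \<in> S" unfolding y by (rule inj_image_mem_iff[OF injG])
    also have "\<dots> \<longleftrightarrow> f ((y - x) \<bullet> e) \<le> (y - x) \<bullet> \<nu>" using graph[OF ball] .
    also have "\<dots> \<longleftrightarrow> c * f (((y' - x') \<bullet> T e) / c) \<le> (y' - x') \<bullet> T \<nu>"
      unfolding x(1) y diff using c by (simp add: inner)
    finally show "y' \<in> ?G ` S \<longleftrightarrow> c * f (((y' - x') \<bullet> T e) / c) \<le> (y' - x') \<bullet> T \<nu>" .
  qed
qed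

section \<open>Dilation invariance of the classical regularity classes\<close>

lemma scaled_interval:
  fixes c r t :: real
  assumes "0 < c" "t \<in> {-(c * r)<..<c * r}" shows "t / c \<in> {-r<..<r}"
  using assms by (auto simp: field_simps)

lemma dilation_invariant_lipschitz: "dilation_invariant lipschitz_class"
  unfolding dilation_invariant_def lipschitz_class_def
proof (intro allI impI, elim exE)
  fix f :: "real \<Rightarrow> real" and r c L :: real
  assume c: "0 < c" and L: "L-lipschitz_on {-r<..<r} f"
  have "L-lipschitz_on {-(c * r)<..<c * r} (\<lambda>t. c * f (t / c))"
  proof (rule lipschitz_onI)
    fix s t assume "s \<in> {-(c * r)<..<c * r}" "t \<in> {-(c * r)<..<c * r}"
    then have "dist (f (s / c)) (f (t / c)) \<le> L * dist (s / c) (t / c)"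
      using scaled_interval[OF c] by (intro lipschitz_onD[OF L]) auto
    then have "c * \<bar>f (s / c) - f (t / c)\<bar> \<le> c * (L * \<bar>s / c - t / c\<bar>)"
      using c by (simp add: dist_real_def)
    also have "\<dots> = L * \<bar>s - t\<bar>" using c by (simp flip: diff_divide_distrib)
    finally show "dist (c * f (s / c)) (c * f (t / c)) \<le> L * dist s t"
      using c by (simp add: dist_real_def abs_mult flip: right_diff_distrib)
  qed (use lipschitz_on_nonneg[OF L] in simp)
  then show "\<exists>L. L-lipschitz_on {-(c * r)<..<c * r} (\<lambda>t. c * f (t / c))" by blast
qed

lemma
  fixes f :: "real \<Rightarrow> real"
  assumes c: "0 < c" and f: "\<And>j t. j < k \<Longrightarrow> t \<in> {-r<..<r} \<Longrightarrow> (deriv ^^ j) f differentiable (at t)"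
  shows funpow_deriv_dilation: "j \<le> k \<Longrightarrow> t \<in> {-(c * r)<..<c * r} \<Longrightarrow>
      (deriv ^^ j) (\<lambda>t. c * f (t / c)) t = c / c ^ j * (deriv ^^ j) f (t / c)"
    and funpow_deriv_dilation_differentiable: "j < k \<Longrightarrow> t \<in> {-(c * r)<..<c * r} \<Longrightarrow>
      (deriv ^^ j) (\<lambda>t. c * f (t / c)) differentiable (at t)"
proof -
  let ?g = "\<lambda>t. c * f (t / c)" and ?I = "{-(c * r)<..<c * r}"
  \<comment> \<open>Each differentiation contributes a factor \<open>1 / c\<close>. The formula of
    order \<open>j\<close> holds only inside the interval, so it is required on the whole open
    interval before it can be differentiated at a point.\<close>
  have step: "((deriv ^^ j) ?g has_field_derivative c / c ^ Suc j * (deriv ^^ Suc j) f (t / c)) (at t)"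
    if eq: "\<And>s. s \<in> ?I \<Longrightarrow> (deriv ^^ j) ?g s = c / c ^ j * (deriv ^^ j) f (s / c)"
      and "j < k" and t: "t \<in> ?I" for j t
  proof -
    have "((deriv ^^ j) f has_field_derivative (deriv ^^ Suc j) f (t / c)) (at (t / c))"
      using f[OF \<open>j < k\<close> scaled_interval[OF c t]] by (simp add: DERIV_deriv_iff_real_differentiable)
    then have "((\<lambda>s. c / c ^ j * (deriv ^^ j) f (s / c)) has_field_derivative
        c / c ^ j * ((deriv ^^ Suc j) f (t / c) * (1 / c))) (at t)"
      by (intro DERIV_cmult DERIV_chain2[where g = "\<lambda>s. s / c"] DERIV_cdivide DERIV_ident)
    then have "((\<lambda>s. c / c ^ j * (deriv ^^ j) f (s / c)) has_field_derivative
        c / c ^ Suc j * (deriv ^^ Suc j) f (t / c)) (at t)"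
      using c by (simp add: field_simps)
    then show ?thesis
      by (rule has_field_derivative_transform_within_open[where S = ?I]) (use t eq in auto)
  qed
  have eq: "\<forall>t\<in>?I. (deriv ^^ j) ?g t = c / c ^ j * (deriv ^^ j) f (t / c)" if "j \<le> k" for j
    using that
  proof (induction j)
    case 0
    then show ?case by simp
  next
    case (Suc j)
    then show ?case using DERIV_imp_deriv[OF step[of j]] by simp
  qed
  then show "j \<le> k \<Longrightarrow> t \<in> ?I \<Longrightarrow> (deriv ^^ j) ?g t = c / c ^ j * (deriv ^^ j) f (t / c)" by blast
  show "j < k \<Longrightarrow> t \<in> ?I \<Longrightarrow> (deriv ^^ j) ?g differentiable (at t)"
    using step[of j t] eq[of j] real_differentiable_def by (metis less_imp_le)
qed

lemma dilation_invariant_Ck: "dilation_invariant (Ck_class k)"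
  unfolding dilation_invariant_def
proof (intro allI impI)
  fix f :: "real \<Rightarrow> real" and r c :: real
  assume c: "0 < c" and "Ck_class k f {-r<..<r}"
  then have f: "\<And>j t. j < k \<Longrightarrow> t \<in> {-r<..<r} \<Longrightarrow> (deriv ^^ j) f differentiable (at t)"
    and cont: "continuous_on {-r<..<r} ((deriv ^^ k) f)"
    by (auto simp: Ck_class_def)
  have "continuous_on {-(c * r)<..<c * r} (\<lambda>t. c / c ^ k * (deriv ^^ k) f (t / c))"
    using scaled_interval[OF c] c
    by (intro continuous_intros continuous_on_compose2[OF cont]) auto
  then have "continuous_on {-(c * r)<..<c * r} ((deriv ^^ k) (\<lambda>t. c * f (t / c)))"
    using funpow_deriv_dilation[where k = k and j = k and r = r, OF c f] by (simp cong: continuous_on_cong_simp)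
  then show "Ck_class k (\<lambda>t. c * f (t / c)) {-(c * r)<..<c * r}"
    using funpow_deriv_dilation_differentiable[where k = k and r = r, OF c f] unfolding Ck_class_def by blast
qed

lemma dilation_invariant_Ck_holder: "dilation_invariant (Ck_holder_class k \<gamma>)"
  unfolding dilation_invariant_def
proof (intro allI impI)
  fix f :: "real \<Rightarrow> real" and r c :: real
  assume r: "0 < r" and c: "0 < c" and "Ck_holder_class k \<gamma> f {-r<..<r}"
  then obtain C where Ck: "Ck_class k f {-r<..<r}" and
    C: "\<And>s t. s \<in> {-r<..<r} \<Longrightarrow> t \<in> {-r<..<r} \<Longrightarrow>
      \<bar>(deriv ^^ k) f s - (deriv ^^ k) f t\<bar> \<le> C * \<bar>s - t\<bar> powr \<gamma>"
    unfolding Ck_holder_class_def by blast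
  let ?g = "\<lambda>t. c * f (t / c)"
  have f: "\<And>j t. j < k \<Longrightarrow> t \<in> {-r<..<r} \<Longrightarrow> (deriv ^^ j) f differentiable (at t)"
    using Ck by (auto simp: Ck_class_def)
  \<comment> \<open>The constant collects \<open>c / c ^ k\<close> from the derivative formula and
    \<open>1 / c powr \<gamma>\<close> from shrinking the increment.\<close>
  have "\<bar>(deriv ^^ k) ?g s - (deriv ^^ k) ?g t\<bar> \<le> (c / c ^ k * C / c powr \<gamma>) * \<bar>s - t\<bar> powr \<gamma>"
    if "s \<in> {-(c * r)<..<c * r}" "t \<in> {-(c * r)<..<c * r}" for s t
  proof -
    have "(deriv ^^ k) ?g s - (deriv ^^ k) ?g t
        = c / c ^ k * ((deriv ^^ k) f (s / c) - (deriv ^^ k) f (t / c))"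
      using funpow_deriv_dilation[where k = k and j = k and r = r, OF c f] that
      by (simp add: right_diff_distrib diff_divide_distrib)
    then have "\<bar>(deriv ^^ k) ?g s - (deriv ^^ k) ?g t\<bar>
        = c / c ^ k * \<bar>(deriv ^^ k) f (s / c) - (deriv ^^ k) f (t / c)\<bar>"
      using c by (simp add: abs_mult)
    also have "\<dots> \<le> c / c ^ k * (C * \<bar>s / c - t / c\<bar> powr \<gamma>)"
      using C[OF scaled_interval[OF c that(1)] scaled_interval[OF c that(2)]] c
      by (intro mult_left_mono) auto
    also have "\<bar>s / c - t / c\<bar> powr \<gamma> = \<bar>s - t\<bar> powr \<gamma> / c powr \<gamma>"
      using c by (simp add: powr_divide flip: diff_divide_distrib)
    finally show ?thesis by simp
  qed
  moreover have "Ck_class k ?g {-(c * r)<..<c * r}"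
    using dilation_invariant_Ck Ck r c unfolding dilation_invariant_def by blast
  ultimately show "Ck_holder_class k \<gamma> ?g {-(c * r)<..<c * r}"
    unfolding Ck_holder_class_def by blast
qed

lemma dilation_invariant_Cinf: "dilation_invariant Cinf_class"
  using dilation_invariant_Ck unfolding dilation_invariant_def Cinf_class_def by blast

text \<open>The expansion of \<open>f\<close> at \<open>t0 / c\<close> is rescaled: the coefficients
  become \<open>c * a n / c ^ n\<close> and the radius \<open>c * \<rho>\<close>.\<close>

lemma dilation_invariant_analytic: "dilation_invariant analytic_class"
  unfolding dilation_invariant_def analytic_class_def
proof (intro allI impI ballI)
  fix f :: "real \<Rightarrow> real" and r c t0 :: real
  assume c: "0 < c" and t0: "t0 \<in> {-(c * r)<..<c * r}"
    and f: "\<forall>t\<^sub>0\<in>{-r<..<r}. \<exists>a \<rho>. \<rho> > 0 \<and>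
      (\<forall>t\<in>{-r<..<r}. \<bar>t - t\<^sub>0\<bar> < \<rho> \<longrightarrow> (\<lambda>n. a n * (t - t\<^sub>0) ^ n) sums f t)"
  obtain a \<rho> where \<rho>: "\<rho> > 0" and
    a: "\<And>t. t \<in> {-r<..<r} \<Longrightarrow> \<bar>t - t0 / c\<bar> < \<rho> \<Longrightarrow> (\<lambda>n. a n * (t - t0 / c) ^ n) sums f t"
    using f scaled_interval[OF c t0] by meson
  show "\<exists>a \<rho>. \<rho> > 0 \<and> (\<forall>t\<in>{-(c * r)<..<c * r}. \<bar>t - t0\<bar> < \<rho> \<longrightarrow>
      (\<lambda>n. a n * (t - t0) ^ n) sums (c * f (t / c)))"
  proof (intro exI conjI ballI impI)
    show "0 < c * \<rho>" using c \<rho> by simp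
    fix t assume t: "t \<in> {-(c * r)<..<c * r}" and "\<bar>t - t0\<bar> < c * \<rho>"
    then have "\<bar>t / c - t0 / c\<bar> < \<rho>" using c by (simp add: field_simps flip: diff_divide_distrib)
    from sums_mult[OF a[OF scaled_interval[OF c t] this], of c]
    show "(\<lambda>n. (c * a n / c ^ n) * (t - t0) ^ n) sums (c * f (t / c))"
      by (simp add: power_divide mult.assoc flip: diff_divide_distrib)
  qed
qed

text \<open>The inverse of a similarity is a similarity with factor \<open>1 / c\<close>, so
  transport in one direction yields the equivalence.\<close>

lemma as_regular_asI:
  assumes T: "orthogonal_transformation T" and c: "0 < c" and S: "S = (\<lambda>x. c *\<^sub>R T x) ` S'"
  shows "as_regular_as S S'"
proof -
  obtain T' where T': "orthogonal_transformation T'" "\<And>x. T' (T x) = x"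
    using orthogonal_transformation_inv[OF T] orthogonal_transformation_inj[OF T] inv_f_f by metis
  have "linear T'" using T'(1) by (simp add: orthogonal_transformation_def)
  then have S': "S' = (\<lambda>x. (1 / c) *\<^sub>R T' x) ` S"
    using c T'(2) by (simp add: S image_image linear_scale)
  have "boundary_of_class R S \<longleftrightarrow> boundary_of_class R S'" if R: "dilation_invariant R" for R
  proof
    assume "boundary_of_class R S"
    then show "boundary_of_class R S'"
      using boundary_of_class_similarity[OF R T'(1), of "1 / c"] c by (subst S') auto
  next
    assume "boundary_of_class R S'"
    then show "boundary_of_class R S"
      using boundary_of_class_similarity[OF R T c] by (subst S) auto
  qed
  then show ?thesis
    unfolding as_regular_as_def
    using dilation_invariant_lipschitz dilation_invariant_Ck dilation_invariant_Ck_holder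
      dilation_invariant_Cinf dilation_invariant_analytic by blast
qed

section \<open>Unit balls of norms\<close>

text \<open>The ball is closed, and the open set \<open>{x. N x < 1}\<close> lies in its
  interior.\<close>

lemma is_norm_frontier_unit_ball:
  fixes N :: "'a::euclidean_space \<Rightarrow> real"
  assumes N: "is_norm N" and x: "x \<in> frontier {x. N x \<le> 1}"
  shows "N x = 1"
proof -
  have "closed {x. N x \<le> 1}" "open {x. N x < 1}"
    using is_norm_continuous[OF N] by (intro closed_Collect_le open_Collect_less continuous_intros; simp)+
  then have "frontier {x. N x \<le> 1} \<subseteq> {x. N x \<le> 1} - {x. N x < 1}"
    using interior_maximal[of "{x. N x < 1}" "{x. N x \<le> 1}"]
    by (force simp: frontier_def subset_iff)
  then show ?thesis using x by auto
qed

lemma rot_orthonormal_expansion: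
  assumes "norm \<nu> = 1"
  shows "(v \<bullet> rot \<nu>) *\<^sub>R rot \<nu> + (v \<bullet> \<nu>) *\<^sub>R \<nu> = v"
proof -
  have \<nu>: "\<nu> $ 1 * \<nu> $ 1 + \<nu> $ 2 * \<nu> $ 2 = 1"
    using assms by (simp add: norm_eq_1 inner_vec_def sum_2)
  have "(v $ 2 * \<nu> $ 1 - v $ 1 * \<nu> $ 2) * - (\<nu> $ 2) + (v $ 1 * \<nu> $ 1 + v $ 2 * \<nu> $ 2) * \<nu> $ 1 = v $ 1"
    "(v $ 2 * \<nu> $ 1 - v $ 1 * \<nu> $ 2) * \<nu> $ 1 + (v $ 1 * \<nu> $ 1 + v $ 2 * \<nu> $ 2) * \<nu> $ 2 = v $ 2"
    using \<nu> by algebra+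
  then show ?thesis by (simp add: vec_eq_iff forall_2 inner_vec_def sum_2)
qed

lemma is_norm_boundary_lipschitz:
  fixes N :: "real^2 \<Rightarrow> real"
  assumes N: "is_norm N"
  shows "boundary_of_class lipschitz_class {x. N x \<le> 1}"
  unfolding boundary_of_class_def
proof
  fix x assume "x \<in> frontier {x. N x \<le> 1}"
  then have Nx: "N x = 1" by (rule is_norm_frontier_unit_ball[OF N])
  then have x0: "x \<noteq> 0" using is_norm_eq_0[OF N, of x] by auto
  obtain K where K: "0 < K" and Klip: "\<And>x y. \<bar>N x - N y\<bar> \<le> K * norm (x - y)"
    using is_norm_lipschitz[OF N] by blast
  define d where "d = norm x"
  \<comment> \<open>The normal points from \<open>x\<close> towards the origin, so that the ball
    lies above the graph; along it the origin is reached at \<open>t = d\<close>.\<close>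
  define \<nu> where "\<nu> = - (x /\<^sub>R d)"
  define e where "e = rot \<nu>"
  have d: "0 < d" using x0 by (simp add: d_def)
  have "norm \<nu> = 1" using d by (simp add: \<nu>_def d_def)
  then have norms: "norm \<nu> = 1" "norm e = 1" "e \<bullet> \<nu> = 0" by (simp_all add: e_def)
  define h where "h s t = N (x + s *\<^sub>R e + t *\<^sub>R \<nu>)" for s t
  have h_lip: "\<bar>h s t - h s' t\<bar> \<le> K * \<bar>s - s'\<bar>" for s s' t
    using Klip[of "x + s *\<^sub>R e + t *\<^sub>R \<nu>" "x + s' *\<^sub>R e + t *\<^sub>R \<nu>"] norms
    by (simp add: h_def flip: scaleR_diff_left)
  have h_axis: "h 0 t = \<bar>1 - t / d\<bar>" for t
  proof -
    have "x + t *\<^sub>R \<nu> = (1 - t / d) *\<^sub>R x" by (simp add: \<nu>_def algebra_simps divide_inverse)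
    then show ?thesis by (simp add: h_def is_norm_scaleR[OF N] Nx)
  qed
  have h_convex: "h s ((1 - u) * t + u * t') \<le> (1 - u) * h s t + u * h s t'"
    if "0 \<le> u" "u \<le> 1" for s t t' u
  proof -
    have "x + s *\<^sub>R e + ((1 - u) * t + u * t') *\<^sub>R \<nu>
        = (1 - u) *\<^sub>R (x + s *\<^sub>R e + t *\<^sub>R \<nu>) + u *\<^sub>R (x + s *\<^sub>R e + t' *\<^sub>R \<nu>)"
      by (simp add: algebra_simps)
    then have "h s ((1 - u) * t + u * t') \<le> N ((1 - u) *\<^sub>R (x + s *\<^sub>R e + t *\<^sub>R \<nu>))
        + N (u *\<^sub>R (x + s *\<^sub>R e + t' *\<^sub>R \<nu>))"
      unfolding h_def by (simp only: is_norm_triangle[OF N])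
    then show ?thesis using that by (simp add: h_def is_norm_scaleR[OF N])
  qed
  \<comment> \<open>The bound \<open>d\<close> keeps the local coordinates inside the window
    \<open>{-d..d}\<close>. The bound \<open>1 / (4 * K)\<close> keeps the variation of
    \<open>N\<close> caused by \<open>s\<close> below 1/4, and the parameter \<open>u\<close> of the
    Lipschitz estimate at most 1.\<close>
  define r where "r = min d (1 / (4 * K))"
  have r: "0 < r" "r \<le> d" "4 * K * r \<le> 1"
    using d K by (auto simp: r_def min_def field_simps)
  have top: "h s d \<le> 1 / 2" and bottom: "1 < h s (- d)" if "\<bar>s\<bar> < r" for s
  proof -
    have "K * \<bar>s\<bar> \<le> K * r" using that K by simp
    then have "K * \<bar>s\<bar> \<le> 1 / 4" using r by simp
    then show "h s d \<le> 1 / 2" "1 < h s (- d)"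
      using h_lip[of s d 0] h_lip[of s "- d" 0] h_axis[of d] h_axis[of "- d"] d by auto
  qed
  \<comment> \<open>The depth at which the ball is first met within the window. The set is compact
    and contains \<open>d\<close>, so the infimum is attained.\<close>
  define f where "f s = Inf {t \<in> {-d..d}. h s t \<le> 1}" for s
  have f_least: "f s \<in> {-d..d}" "h s (f s) \<le> 1" and f_le: "\<And>t. t \<in> {-d..d} \<Longrightarrow> h s t \<le> 1 \<Longrightarrow> f s \<le> t"
    if s: "\<bar>s\<bar> < r" for s
  proof -
    let ?A = "{t \<in> {-d..d}. h s t \<le> 1}"
    have cont: "continuous_on UNIV (h s)"
      unfolding h_def
      by (intro continuous_on_compose2[OF is_norm_continuous[OF N, of UNIV]] continuous_intros) auto
    have "closed ({-d..d} \<inter> {t. h s t \<le> 1})"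
      by (intro closed_Int closed_Collect_le cont continuous_intros closed_atLeastAtMost)
    moreover have "{-d..d} \<inter> {t. h s t \<le> 1} = ?A" by auto
    ultimately have "closed ?A" by simp
    moreover have "d \<in> ?A" using top[OF s] d by auto
    moreover have bdd: "bdd_below ?A" by (rule bdd_belowI[of _ "-d"]) auto
    ultimately have "f s \<in> ?A" unfolding f_def by (intro closed_contains_Inf) auto
    then show "f s \<in> {-d..d}" "h s (f s) \<le> 1" by auto
    show "f s \<le> t" if "t \<in> {-d..d}" "h s t \<le> 1" for t
      unfolding f_def using that bdd by (intro cInf_lower) auto
  qed
  have graph: "h s t \<le> 1 \<longleftrightarrow> f s \<le> t" if s: "\<bar>s\<bar> < r" and t: "\<bar>t\<bar> < r" for s t
  proof
    have "t \<in> {-d..d}" using t r by auto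
    then show "h s t \<le> 1 \<Longrightarrow> f s \<le> t" by (rule f_le[OF s])
    assume le: "f s \<le> t"
    \<comment> \<open>\<open>t\<close> is written as a convex combination of \<open>f s\<close> and
      \<open>d\<close>, where \<open>h s\<close> is at most 1. If \<open>f s = d\<close>, then
      \<open>t = d\<close> and the quotient is avoided.\<close>
    define u where "u = (if f s = d then 0 else (t - f s) / (d - f s))"
    have fd: "f s \<le> d" and td: "t \<le> d" using f_least[OF s] t r by auto
    then have u: "0 \<le> u" "u \<le> 1" and t_eq: "t = (1 - u) * f s + u * d"
      using le by (auto simp: u_def field_simps)
    have "h s t \<le> (1 - u) * h s (f s) + u * h s d"
      unfolding t_eq by (rule h_convex[OF u])
    also have "\<dots> \<le> (1 - u) * 1 + u * 1"
      using u f_least(2)[OF s] top[OF s] by (intro add_mono mult_left_mono) auto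
    finally show "h s t \<le> 1" by simp
  qed
  have f_step: "f s' \<le> f s + 4 * d * K * \<bar>s - s'\<bar>" if s: "\<bar>s\<bar> < r" and s': "\<bar>s'\<bar> < r" for s s'
  proof -
    \<comment> \<open>Moving from \<open>f s\<close> towards \<open>d\<close>, where \<open>N\<close> is at most one half, gains by convexity what
      replacing \<open>s\<close> by \<open>s'\<close> may lose.\<close>
    define u where "u = 2 * K * \<bar>s - s'\<bar>"
    have "\<bar>s - s'\<bar> \<le> 2 * r" using s s' by linarith
    then have "u \<le> 2 * K * (2 * r)" unfolding u_def using K by (intro mult_left_mono) auto
    then have "u \<le> 1" using r by linarith
    moreover have "0 \<le> u" using K by (simp add: u_def)
    ultimately have u: "0 \<le> u" "u \<le> 1" by auto
    have "h s' (f s) \<le> 1 + u / 2"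
      using h_lip[of s "f s" s'] f_least(2)[OF s] by (simp add: u_def)
    then have "(1 - u) * h s' (f s) \<le> (1 - u) * (1 + u / 2)"
      using u by (intro mult_left_mono) auto
    moreover have "u * h s' d \<le> u * (1 / 2)" using u top[OF s'] by (intro mult_left_mono) auto
    \<comment> \<open>The left side equals \<open>1 - u * u / 2\<close>.\<close>
    moreover have "(1 - u) * (1 + u / 2) + u * (1 / 2) \<le> 1"
      using u by (simp add: algebra_simps)
    ultimately have "h s' ((1 - u) * f s + u * d) \<le> 1"
      using h_convex[OF u, of s' "f s" d] by linarith
    moreover have "(1 - u) * f s + u * d \<in> {-d..d}"
    proof -
      have "(1 - u) * f s + u * d \<in> closed_segment (f s) d"
        using u by (auto simp: closed_segment_def intro!: exI[of _ u])
      then show ?thesis using f_least(1)[OF s] d by (auto simp: closed_segment_eq_real_ivl)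
    qed
    ultimately have "f s' \<le> (1 - u) * f s + u * d" by (intro f_le[OF s'])
    also have "\<dots> = f s + u * (d - f s)" by (simp add: algebra_simps)
    \<comment> \<open>\<open>f s\<close> is at least \<open>-d\<close>; with the value of
      \<open>u\<close> this gives the constant \<open>4 * d * K\<close>.\<close>
    also have "\<dots> \<le> f s + u * (2 * d)"
      using u f_least(1)[OF s] by (intro add_left_mono mult_left_mono) auto
    finally show ?thesis by (simp add: u_def mult_ac)
  qed
  have "lipschitz_class f {-r<..<r}"
    unfolding lipschitz_class_def
  proof (intro exI lipschitz_onI)
    fix s s' assume "s \<in> {-r<..<r}" "s' \<in> {-r<..<r}"
    then have "\<bar>s\<bar> < r" "\<bar>s'\<bar> < r" by auto
    then show "dist (f s) (f s') \<le> (4 * d * K) * dist s s'"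
      using f_step[of s s'] f_step[of s' s] by (simp add: dist_real_def abs_minus_commute abs_le_iff)
  qed (use d K in simp)
  moreover have "y \<in> {x. N x \<le> 1} \<longleftrightarrow> f ((y - x) \<bullet> e) \<le> (y - x) \<bullet> \<nu>" if "y \<in> ball x r" for y
  proof -
    have less: "norm (y - x) < r" using that by (simp add: dist_norm norm_minus_commute)
    have "\<bar>(y - x) \<bullet> e\<bar> < r" "\<bar>(y - x) \<bullet> \<nu>\<bar> < r"
      using less Cauchy_Schwarz_ineq2[of "y - x" e] Cauchy_Schwarz_ineq2[of "y - x" \<nu>] norms by auto
    moreover have "h ((y - x) \<bullet> e) ((y - x) \<bullet> \<nu>) = N y"
      using rot_orthonormal_expansion[OF norms(1), of "y - x"]
      unfolding h_def e_def[symmetric] add.assoc by simp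
    ultimately show ?thesis using graph[of "(y - x) \<bullet> e" "(y - x) \<bullet> \<nu>"] by simp
  qed
  ultimately show "\<exists>e \<nu> r f. norm e = 1 \<and> norm \<nu> = 1 \<and> e \<bullet> \<nu> = 0 \<and> r > 0 \<and>
      lipschitz_class f {-r<..<r} \<and>
      (\<forall>y\<in>ball x r. y \<in> {x. N x \<le> 1} \<longleftrightarrow> f ((y - x) \<bullet> e) \<le> (y - x) \<bullet> \<nu>)"
    using norms r by blast
qed

section \<open>The explicit unit balls and the final statement\<close>

lemma lq_norm_scaleR:
  assumes "1 \<le> q" shows "lq_norm q (c *\<^sub>R x) = \<bar>c\<bar> * lq_norm q x"
proof (cases "q = \<infinity>")
  case True
  then show ?thesis by (simp add: lq_norm_def infnorm_mul)
next
  case False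
  define p where "p = real_of_ereal q"
  have p: "1 \<le> p" using assms False by (cases q) (auto simp: p_def)
  have "(\<Sum>i\<in>UNIV. \<bar>(c *\<^sub>R x) $ i\<bar> powr p) = \<bar>c\<bar> powr p * (\<Sum>i\<in>UNIV. \<bar>x $ i\<bar> powr p)"
    by (simp add: abs_mult powr_mult sum_distrib_left)
  then show ?thesis
    using False p by (simp add: lq_norm_def p_def[symmetric] powr_mult powr_powr sum_nonneg)
qed

text \<open>A right-angle rotation only swaps the coordinates up to sign, so an
  \<open>lq_norm\<close> ball is carried to itself.\<close>

lemma lq_norm_rot [simp]: "lq_norm q (rot x) = lq_norm q x"
  by (auto simp: lq_norm_def infnorm_2 sum_2 add.commute max.commute)

text \<open>The radius is \<open>lam / 4\<close> where the English statement has the constant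
  itself: with the factor 2 and the integral over the whole line \<open>p^perp\<close>, as
  \<open>Phi\<close> is defined, the formula for \<open>Phi\<close> carries the factor
  \<open>lam / 4\<close>. The exchange of \<open>a\<close> and \<open>b\<close> reflects the swap of
  coordinates by \<open>rot\<close>.\<close>

theorem corollary3p11:
  fixes \<alpha> a b lam :: real and q :: ereal and N :: "real^2 \<Rightarrow> real"
  assumes "0 < \<alpha>" and "\<alpha> < 2"
    and "is_norm N"
    and "0 < a" and "0 < b"
    and "1 \<le> q"
    and "0 < lam"
    and "inverse lam = (LBINT t:{0..}. 1 / (1 + t powr (2 + \<alpha>)))"
  shows "convex {p. Phi \<alpha> N p \<le> 1} \<and> convex {x. N x \<le> 1} \<and>
    as_regular_as {p. Phi \<alpha> N p \<le> 1} {x. N x \<le> 1} \<and>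
    boundary_of_class lipschitz_class {x. N x \<le> 1} \<and>
    ({p. Phi \<alpha> N p \<le> 1} = {p. (p $ 1)\<^sup>2 / a\<^sup>2 + (p $ 2)\<^sup>2 / b\<^sup>2 \<le> 1} \<longrightarrow>
      {x. N x \<le> 1} = {p. (p $ 1)\<^sup>2 / b\<^sup>2 + (p $ 2)\<^sup>2 / a\<^sup>2 \<le> (lam / 4)\<^sup>2}) \<and>
    ({p. Phi \<alpha> N p \<le> 1} = {p. lq_norm q p \<le> 1} \<longrightarrow>
      {x. N x \<le> 1} = {p. lq_norm q p \<le> lam / 4})"
proof -
  note N = \<open>is_norm N\<close>
  let ?G = "\<lambda>x. (4 / lam) *\<^sub>R rot x" and ?S = "{p. Phi \<alpha> N p \<le> 1}" and ?B = "{x. N x \<le> 1}"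
  have lam: "0 < lam" by fact
  have Phi: "Phi \<alpha> N p = lam / 4 * N (rot p)" for p
    by (rule Phi_eq[OF N lam]) fact
  \<comment> \<open>Applying \<open>rot\<close> twice gives \<open>-x\<close>, which has the same
    norm, and the factors \<open>lam / 4\<close> and \<open>4 / lam\<close> cancel.\<close>
  have mem: "N x \<le> 1 \<longleftrightarrow> ?G x \<in> ?S" for x
    using lam by (simp add: Phi linear_scale[OF linear_rot] is_norm_scaleR[OF N] is_norm_minus[OF N])
  have S_eq: "?S = ?G ` ?B"
  proof (intro equalityI subsetI)
    fix p assume p: "p \<in> ?S"
    \<comment> \<open>Since \<open>rot\<close> squares to minus the identity, the inverse of
      \<open>?G\<close> is \<open>rot\<close> scaled by \<open>- (lam / 4)\<close>.\<close>
    have eq: "?G (- (lam / 4) *\<^sub>R rot p) = p"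
      using lam by (simp add: linear_scale[OF linear_rot] linear_neg[OF linear_rot])
    then have "- (lam / 4) *\<^sub>R rot p \<in> ?B"
      using p unfolding mem_Collect_eq[of _ "\<lambda>x. N x \<le> 1"] mem by simp
    then have "?G (- (lam / 4) *\<^sub>R rot p) \<in> ?G ` ?B" by (rule imageI)
    then show "p \<in> ?G ` ?B" unfolding eq .
  next
    fix p assume "p \<in> ?G ` ?B"
    then show "p \<in> ?S" using mem by auto
  qed
  have rot: "orthogonal_transformation rot"
    using linear_rot by (simp add: orthogonal_transformation_def)
  have convex: "convex ?B"
  proof (rule convexI)
    fix x y and u v :: real
    assume *: "x \<in> ?B" "y \<in> ?B" "0 \<le> u" "0 \<le> v" "u + v = 1"
    have "N (u *\<^sub>R x + v *\<^sub>R y) \<le> u * N x + v * N y"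
      using is_norm_triangle[OF N, of "u *\<^sub>R x" "v *\<^sub>R y"] * by (simp add: is_norm_scaleR[OF N])
    also have "\<dots> \<le> 1" using * convex_bound_le[of "N x" 1 "N y" u v] by simp
    finally show "u *\<^sub>R x + v *\<^sub>R y \<in> ?B" by simp
  qed
  moreover have "convex ?S"
    unfolding S_eq by (intro convex_linear_image linear_compose_scale_right linear_rot convex)
  moreover have "as_regular_as ?S ?B"
    using lam by (intro as_regular_asI[OF rot _ S_eq]) simp
  moreover have "?B = {p. (p $ 1)\<^sup>2 / b\<^sup>2 + (p $ 2)\<^sup>2 / a\<^sup>2 \<le> (lam / 4)\<^sup>2}"
    if "?S = {p. (p $ 1)\<^sup>2 / a\<^sup>2 + (p $ 2)\<^sup>2 / b\<^sup>2 \<le> 1}"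
  proof -
    have "N x \<le> 1 \<longleftrightarrow> (4 / lam)\<^sup>2 * ((x $ 1)\<^sup>2 / b\<^sup>2 + (x $ 2)\<^sup>2 / a\<^sup>2) \<le> 1" for x
      unfolding mem that by (simp add: power_mult_distrib power_divide algebra_simps)
    moreover have "(4 / lam)\<^sup>2 * z \<le> 1 \<longleftrightarrow> z \<le> (lam / 4)\<^sup>2" for z
      using lam by (simp add: field_simps power2_eq_square)
    ultimately show ?thesis by simp
  qed
  moreover have "?B = {p. lq_norm q p \<le> lam / 4}" if "?S = {p. lq_norm q p \<le> 1}"
    unfolding mem that using lam \<open>1 \<le> q\<close> by (auto simp: lq_norm_scaleR field_simps)
  ultimately show ?thesis
    using is_norm_boundary_lipschitz[OF N] by blast
qed

end
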